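(* Let $\Omega\subseteq\mathbb{R}^{d+k}$ be a nonempty bounded set of the form $$\Omega=\left\{(\mathbf{x},\mathbf{y})\ \middle|\ \mathbf{x}_s\in y^s\otimes\Lambda_s+(1-y^s)\otimes\Gamma_s\ (s\in\mathcal{K}),\ \mathbf{x}=\{\mathbf{x}_s\}_{s\in\mathcal{K}},\ \mathbf{A}\mathbf{y}\le\mathbf{b},\ \mathbf{y}\in\{0,1\}^k\right\},$$ where $\mathcal{K}=\{1,\dots,k\}$, $\mathbf{A}$ is a totally unimodular matrix, $\mathbf{b}$ is an integer vector, $\{\mathbf{y}\in\mathbb{R}^k\mid\mathbf{A}\mathbf{y}\le\mathbf{b}\}\subseteq[0,1]^k$, and $\Lambda_s,\Gamma_s$ are the nonempty convex sets $\Lambda_s=\{\mathbf{x}_s\mid h_l(\mathbf{x}_s,1)\le d_l,\ l\in\mathcal{H}_s\}$ and $\Gamma_s=\{\mathbf{x}_s\mid h_l(\mathbf{x}_s,0)\le d_l,\ l\in\mathcal{H}_s\}$, with $\mathcal{H}_s$ a finite index set, $h_l$ a closed convex function of $(\mathbf{x}_s,y^s)$ and $d_l\in\mathbb{R}$ for each $l\in\mathcal{H}_s$. Then for any $r\in\mathbb{Z}_+$, $$r\otimes\Omega=\left\{(\mathbf{X},\mathbf{Y})\ \middle|\ \mathbf{X}_s\in Y^s\odot\Lambda_s+(r-Y^s)\odot\Gamma_s\ (s\in\mathcal{K}),\ \mathbf{X}=\{\mathbf{X}_s\}_{s\in\mathcal{K}},\ \mathbf{A}\mathbf{Y}\le r\mathbf{b},\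 \mathbf{Y}\in\{0,1,\dots,r\}^k\right\}.$$
   Context: $\mathbb{Z}_+$ is the set of nonnegative integers. The vector $\mathbf{x}\in\mathbb{R}^d$ is partitioned into subvectors $\mathbf{x}_s$ ($s\in\mathcal{K}$), written $\mathbf{x}=\{\mathbf{x}_s\}_{s\in\mathcal{K}}$ (concatenation); $y^s$ is the $s$-th entry of $\mathbf{y}$. The same partition is used for $\mathbf{X}\in\mathbb{R}^d$, and $Y^s$ is the $s$-th entry of $\mathbf{Y}\in\mathbb{R}^k$. The sum of two sets is the Minkowski sum. For a nonempty set $\mathcal{F}$ in a Euclidean space and a nonnegative integer $p$: $p\otimes\mathcal{F}=\{\sum_{i=1}^p\mathbf{x}_i\mid\mathbf{x}_1,\dots,\mathbf{x}_p\in\mathcal{F}\}$ if $p>0$, and $p\otimes\mathcal{F}=\{\mathbf{0}\}$ if $p=0$. For a nonempty set $\mathcal{F}$ and a real number $r\ge0$: $r\odot\mathcal{F}=\{r\mathbf{x}\mid\mathbf{x}\in\mathcal{F}\}$ if $r>0$, and $r\odot\mathcal{F}=\{\mathbf{0}\}$ if $r=0$. *)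

theory Defs
  imports
    "Jordan_Normal_Form.Determinant"
    "HOL-Analysis.Analysis"
begin

no_notation Matrix.vec_index (infixl "$" 100)

(* A subvector x_s lives in R^(d_s).  As the block sizes d_s differ, R^(d_s) is realised as the
   coordinate subspace of real^'d carried by the coordinates i with blk i = s, where
   blk :: 'd => 'k is the partition of the coordinates into blocks. *)

definition block_space :: "('d::finite \<Rightarrow> 'k) \<Rightarrow> 'k \<Rightarrow> (real ^ 'd) set" where
  "block_space blk s = {x. \<forall>i. blk i \<noteq> s \<longrightarrow> x $ i = 0}"

definition subvec :: "('d::finite \<Rightarrow> 'k) \<Rightarrow> 'k \<Rightarrow> real ^ 'd \<Rightarrow> real ^ 'd" where
  "subvec blk s x = (\<chi> i. if blk i = s then x $ i else 0)"

definition nfold_sum :: "nat \<Rightarrow> 'a::euclidean_space set \<Rightarrow> 'a set" where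
  "nfold_sum p F = (if p > 0 then {\<Sum>i=1..p. x i | x. \<forall>i\<in>{1..p}. x i \<in> F} else {0})"

(* Only used for r >= 0.  The case r = 0 is separate because it is not meant to depend on F. *)
definition dilate :: "real \<Rightarrow> 'a::euclidean_space set \<Rightarrow> 'a set" where
  "dilate r F = (if r > 0 then {r *\<^sub>R x | x. x \<in> F} else {0})"

(* Convex functions are extended-real-valued; on the domain D, a function is closed convex iff
   its epigraph is a closed and convex set.  Values of f outside D are irrelevant. *)
definition ereal_epigraph :: "'a set \<Rightarrow> ('a \<Rightarrow> ereal) \<Rightarrow> ('a \<times> real) set" where
  "ereal_epigraph D f = {(z, t). z \<in> D \<and> f z \<le> ereal t}"

definition closed_convex_fun_on :: "'a::euclidean_space set \<Rightarrow> ('a \<Rightarrow> ereal) \<Rightarrow> bool" where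
  "closed_convex_fun_on D f \<longleftrightarrow> closed (ereal_epigraph D f) \<and> convex (ereal_epigraph D f)"

(* The index types are unordered, so a t x t submatrix is given by injective enumerations f of its
   rows and g of its columns; reordering them only changes the sign of the determinant. *)
definition totally_unimodular :: "real ^ 'n ^ 'm \<Rightarrow> bool" where
  "totally_unimodular A \<longleftrightarrow>
     (\<forall>t (f :: nat \<Rightarrow> 'm) (g :: nat \<Rightarrow> 'n). inj_on f {..<t} \<and> inj_on g {..<t} \<longrightarrow>
        Determinant.det (Matrix.mat t t (\<lambda>(i, j). A $ f i $ g j)) \<in> {-1, 0, 1})"

end

theory Submission
  imports Defs
begin

text \<open>The substance is Baum and Trotter's integer decomposition of totally unimodular polytopes:
  if \<open>Y\<close> is integral and \<open>A Y \<le> r b\<close>, then \<open>{y. A y \<le> b, A (Y - y) \<le> (r - 1) b}\<close> contains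
  \<open>Y / r\<close>, hence an integral point (Hoffman and Kruskal), which is split off from \<open>Y\<close>. The summands
  are \<open>0/1\<close> vectors, and each block of \<open>X\<close> is distributed over them by taking one fixed point of
  \<open>\<Lambda> s\<close> or \<open>\<Gamma> s\<close>. The other inclusion is convexity.\<close>

section \<open>Integer matrices of determinant 1 or -1\<close>

lemma det_in_Ints:
  fixes M :: "'a::comm_ring_1 Matrix.mat"
  assumes "M \<in> carrier_mat n n" "\<And>i j. i < n \<Longrightarrow> j < n \<Longrightarrow> M $$ (i, j) \<in> \<int>"
  shows "Determinant.det M \<in> \<int>"
proof -
  have "signof p * (\<Prod>i = 0..<n. M $$ (i, p i)) \<in> \<int>" if p: "p permutes {0..<n}" for p
  proof -
    have "M $$ (i, p i) \<in> \<int>" if "i \<in> {0..<n}" for i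
      using that assms(2) permutes_in_image[OF p] by auto
    then show ?thesis by (intro Ints_mult Ints_prod) (auto simp: sign_def)
  qed
  then show ?thesis
    unfolding det_def'[OF assms(1)] by (intro Ints_sum) auto
qed

text \<open>This is Cramer's rule. The adjugate of \<open>M\<close> has integer entries, since
  cofactors are signed determinants of integer matrices, and applying it to the integral vector
  \<open>M v\<close> returns \<open>v\<close> up to sign.\<close>

lemma unimodular_solution_in_Ints:
  fixes M :: "real Matrix.mat"
  assumes M: "M \<in> carrier_mat n n"
    and M_int: "\<And>i j. i < n \<Longrightarrow> j < n \<Longrightarrow> M $$ (i, j) \<in> \<int>"
    and det: "Determinant.det M \<in> {-1, 1}"
    and v: "v \<in> carrier_vec n"
    and Mv: "\<And>i. i < n \<Longrightarrow> vec_index (M *\<^sub>v v) i \<in> \<int>"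
    and j: "j < n"
  shows "vec_index v j \<in> \<int>"
proof -
  note adj = adj_mat[OF M]
  have adj_int: "adj_mat M $$ (i, k) \<in> \<int>" if "i < n" "k < n" for i k
  proof -
    have "Determinant.det (mat_delete M k i) \<in> \<int>"
    proof (rule det_in_Ints)
      show "mat_delete M k i \<in> carrier_mat (n - 1) (n - 1)"
        using M by (auto simp: mat_delete_def)
      show "mat_delete M k i $$ (a, c) \<in> \<int>" if "a < n - 1" "c < n - 1" for a c
        using that M by (auto simp: mat_delete_def intro!: M_int)
    qed
    then show ?thesis using that M by (auto simp: adj_mat_def cofactor_def)
  qed
  have "adj_mat M *\<^sub>v (M *\<^sub>v v) = (adj_mat M * M) *\<^sub>v v"
    using assoc_mult_mat_vec[OF adj(1) M v] by simp
  also have "\<dots> = Determinant.det M \<cdot>\<^sub>v v"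
    using v by (auto simp: adj(3))
  finally have "Determinant.det M * vec_index v j = vec_index (adj_mat M *\<^sub>v (M *\<^sub>v v)) j"
    using v j by simp
  also have "\<dots> = (\<Sum>k = 0..<n. adj_mat M $$ (j, k) * vec_index (M *\<^sub>v v) k)"
    using adj(1) M j by (auto simp: scalar_prod_def intro!: sum.cong)
  also have "\<dots> \<in> \<int>"
    using adj_int Mv j by (intro Ints_sum Ints_mult) auto
  finally show ?thesis using det by auto
qed

section \<open>Integral points of totally unimodular polytopes\<close>

text \<open>Each entry is a minor of order 1.\<close>

lemma totally_unimodular_entry_in_Ints:
  assumes "totally_unimodular A"
  shows "A $ i $ j \<in> \<int>"
proof -
  define M where "M = Matrix.mat 1 1 (\<lambda>(_ :: nat, _ :: nat). A $ i $ j)"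
  have "inj_on (\<lambda>_. i) {..<1 :: nat}" "inj_on (\<lambda>_. j) {..<1 :: nat}"
    by (auto simp: inj_on_def)
  then have "Determinant.det M \<in> {-1, 0, 1}"
    using assms unfolding totally_unimodular_def M_def by blast
  moreover have "Determinant.det M = A $ i $ j"
    using det_single[of M] by (simp add: M_def)
  ultimately show ?thesis by auto
qed

text \<open>A basis of the whole space chosen among the rows in \<open>I\<close> forms a nonsingular
  square submatrix, whose determinant total unimodularity forces to be 1 or -1. Hence
  \<open>y\<close> solves a unimodular system with integral right-hand side.\<close>

lemma spanning_rows_solution_in_Ints:
  fixes A :: "real ^ 'n ^ 'm"
  assumes tu: "totally_unimodular A"
    and span: "span ((\<lambda>i. A $ i) ` I) = UNIV"
    and int: "\<And>i. i \<in> I \<Longrightarrow> (A *v y) $ i \<in> \<int>"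
  shows "y $ j \<in> \<int>"
proof -
  obtain B where B: "B \<subseteq> (\<lambda>i. A $ i) ` I" "independent B" "span B = UNIV"
    using maximal_independent_subset[of "(\<lambda>i. A $ i) ` I"] span
    by (metis span_mono span_span top.extremum_unique)
  define n where "n = CARD('n)"
  have card_B: "card B = n"
    using B dim_eq_card[of B UNIV] by (simp add: n_def)
  have fin_B: "finite B" using B independent_imp_finite by blast
  obtain e where e: "bij_betw e {..<n} B"
    using ex_bij_betw_nat_finite[OF fin_B] card_B by (metis atLeast0LessThan)
  obtain g :: "nat \<Rightarrow> 'n" where g: "bij_betw g {..<n} UNIV"
    using ex_bij_betw_nat_finite[of "UNIV :: 'n set"] by (auto simp: n_def atLeast0LessThan)
  \<comment> \<open>Distinct indices may carry the same row of \<open>A\<close>, so one index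
    \<open>f p\<close> is picked for each basis vector \<open>e p\<close>; \<open>f\<close> is then
    injective because \<open>e\<close> is.\<close>
  have "\<forall>p\<in>{..<n}. \<exists>i\<in>I. A $ i = e p"
    using B(1) e by (fastforce simp: bij_betw_def)
  then obtain f where f: "\<And>p. p < n \<Longrightarrow> f p \<in> I" "\<And>p. p < n \<Longrightarrow> A $ f p = e p"
    by (metis lessThan_iff)
  have "inj_on f {..<n}"
    by (rule inj_onI) (metis e f(2) bij_betw_imp_inj_on inj_on_def lessThan_iff)
  moreover have inj_g: "inj_on g {..<n}" using g by (simp add: bij_betw_def)
  moreover define M where "M = Matrix.mat n n (\<lambda>(i, j). A $ f i $ g j)"
  ultimately have det: "Determinant.det M \<in> {-1, 0, 1}"
    using tu unfolding totally_unimodular_def by blast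
  have M: "M \<in> carrier_mat n n" by (simp add: M_def)
  \<comment> \<open>This translates between the two matrix libraries: position \<open>q\<close> of
    the numbered vector holds the coordinate \<open>g q\<close> of \<open>z\<close>.\<close>
  have mult: "vec_index (M *\<^sub>v Matrix.vec n (\<lambda>q. z $ g q)) p = (A *v z) $ f p"
    if "p < n" for p z
  proof -
    have "vec_index (M *\<^sub>v Matrix.vec n (\<lambda>q. z $ g q)) p = (\<Sum>q\<in>{..<n}. A $ f p $ g q * z $ g q)"
      using that by (auto simp: M_def scalar_prod_def atLeast0LessThan intro!: sum.cong)
    also have "\<dots> = (A *v z) $ f p"
      using sum.reindex_bij_betw[OF g, of "\<lambda>q. A $ f p $ q * z $ q"]
      by (simp add: matrix_vector_mult_def)
    finally show ?thesis .
  qed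
  \<comment> \<open>A kernel vector of \<open>M\<close>, carried back along \<open>g\<close>, is
    orthogonal to every row in \<open>B\<close>. These rows span the space, so it is orthogonal to
    itself and vanishes.\<close>
  have "Determinant.det M \<noteq> 0"
  proof
    assume "Determinant.det M = 0"
    then obtain v where v: "v \<in> carrier_vec n" "v \<noteq> 0\<^sub>v n" "M *\<^sub>v v = 0\<^sub>v n"
      using det_0_iff_vec_prod_zero_field[OF M] by blast
    define z :: "real ^ 'n" where "z = (\<chi> j. vec_index v (inv_into {..<n} g j))"
    have v_eq: "v = Matrix.vec n (\<lambda>q. z $ g q)"
      using v(1) inj_g by (intro eq_vecI) (auto simp: z_def)
    have "orthogonal z w" if "w \<in> B" for w
    proof -
      have "w \<in> e ` {..<n}" using that bij_betw_imp_surj_on[OF e] by simp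
      then obtain p where p: "p < n" "w = A $ f p" using f(2) by auto
      have "(A *v z) $ f p = 0"
        using mult[OF p(1), of z] v(3) v_eq p(1) by simp
      then show ?thesis
        by (simp add: p(2) orthogonal_def matrix_vector_mult_def inner_vec_def mult.commute)
    qed
    then have "orthogonal z z"
      using B(3) orthogonal_to_span by (metis UNIV_I)
    then have "z = 0" by (simp add: orthogonal_self)
    then show False using v(2) v_eq by auto
  qed
  then have det': "Determinant.det M \<in> {-1, 1}" using det by auto
  obtain p where p: "p < n" "g p = j"
    using bij_betw_imp_surj_on[OF g] by (metis UNIV_I imageE lessThan_iff)
  have "vec_index (Matrix.vec n (\<lambda>q. y $ g q)) p \<in> \<int>"
  proof (rule unimodular_solution_in_Ints[OF M _ det' _ _ p(1)])
    show "M $$ (i, j) \<in> \<int>" if "i < n" "j < n" for i j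
      using that totally_unimodular_entry_in_Ints[OF tu] by (simp add: M_def)
    show "vec_index (M *\<^sub>v Matrix.vec n (\<lambda>q. y $ g q)) i \<in> \<int>" if "i < n" for i
      using mult[OF that] int f(1)[OF that] by simp
  qed auto
  then show ?thesis using p by simp
qed

text \<open>The polytope is compact, convex and nonempty, so it has an extreme point, and every
  extreme point is integral. Treating both bounds at once avoids proving that \<open>A\<close>
  stacked on its negative is totally unimodular.\<close>

lemma totally_unimodular_integral_point:
  fixes A :: "real ^ 'n ^ 'm"
  assumes tu: "totally_unimodular A"
    and l: "\<And>i. l $ i \<in> \<int>" and u: "\<And>i. u $ i \<in> \<int>"
    and bounded: "bounded {y. l \<le> A *v y \<and> A *v y \<le> u}"
    and nonempty: "{y. l \<le> A *v y \<and> A *v y \<le> u} \<noteq> {}"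
  obtains y where "l \<le> A *v y" "A *v y \<le> u" "\<And>j. y $ j \<in> \<int>"
proof -
  define P where "P = {y. l \<le> A *v y \<and> A *v y \<le> u}"
  have P_vimage: "P = (*v) A -` cbox l u"
    by (auto simp: P_def interval_cbox_cart[symmetric])
  have "closed P" unfolding P_vimage
    by (intro closed_vimage closed_cbox linear_continuous_on
        linear_conv_bounded_linear[THEN iffD1] matrix_vector_mul_linear)
  then have "compact P" using bounded by (simp add: P_def compact_eq_bounded_closed)
  moreover have "convex P" unfolding P_vimage
    by (intro convex_linear_vimage convex_box matrix_vector_mul_linear)
  ultimately obtain y where y: "y extreme_point_of P"
    using nonempty extreme_point_exists_convex unfolding P_def by blast
  \<comment> \<open>\<open>I\<close> contains every row tight at \<open>y\<close>, because
    \<open>l\<close> and \<open>u\<close> are integral. It may contain more rows, which does no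
    harm: integrality of \<open>A y\<close> on a spanning set of rows is all that is used.\<close>
  define I where "I = {i. (A *v y) $ i \<in> \<int>}"
  have yP: "y \<in> P" using y by (simp add: extreme_point_of_def)
  have "span ((\<lambda>i. A $ i) ` I) = UNIV"
  proof (rule ccontr)
    assume "span ((\<lambda>i. A $ i) ` I) \<noteq> UNIV"
    \<comment> \<open>If the rows in \<open>I\<close> do not span, some direction \<open>z\<close>
      is orthogonal to all of them. Moving from \<open>y\<close> a little way along \<open>z\<close>
      or its negative stays in \<open>P\<close>, so \<open>y\<close> is the midpoint of a
      nondegenerate segment of \<open>P\<close>. The factor \<open>c\<close> below stands for the
      two signs.\<close>
    then obtain z where z: "z \<noteq> 0" "\<And>w. w \<in> span ((\<lambda>i. A $ i) ` I) \<Longrightarrow> z \<bullet> w = 0"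
      using span_not_UNIV_orthogonal by blast
    have Az: "(A *v z) $ i = 0" if "i \<in> I" for i
      using z(2)[OF span_base[OF imageI[OF that]]]
      by (simp add: matrix_vector_mult_def inner_vec_def mult.commute)
    have "\<forall>\<^sub>F \<epsilon> in at_right 0. l $ i \<le> (A *v (y + (c * \<epsilon>) *\<^sub>R z)) $ i \<and> (A *v (y + (c * \<epsilon>) *\<^sub>R z)) $ i \<le> u $ i"
      for i and c :: real
    proof -
      have eq: "(A *v (y + (c * \<epsilon>) *\<^sub>R z)) $ i = (A *v y) $ i + (c * \<epsilon>) * (A *v z) $ i" for \<epsilon>
        by (simp add: matrix_vector_right_distrib matrix_vector_mult_scaleR)
      have le: "l $ i \<le> (A *v y) $ i" "(A *v y) $ i \<le> u $ i"
        using yP by (auto simp: P_def less_eq_vec_def)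
      show ?thesis
      proof (cases "i \<in> I")
        case True
        then show ?thesis using le by (simp add: eq Az)
      next
        case False
        \<comment> \<open>Outside \<open>I\<close> neither bound can be attained, the bounds being
          integers, so there is room for a small move.\<close>
        then have lt: "l $ i < (A *v y) $ i" "(A *v y) $ i < u $ i"
          using le l u by (auto simp: I_def less_le) metis+
        have "((\<lambda>\<epsilon>. (A *v y) $ i + (c * \<epsilon>) * (A *v z) $ i) \<longlongrightarrow> (A *v y) $ i + (c * 0) * (A *v z) $ i) (at_right 0)"
          by (intro tendsto_intros)
        then have "\<forall>\<^sub>F \<epsilon> in at_right 0. l $ i < (A *v y) $ i + (c * \<epsilon>) * (A *v z) $ i"
          "\<forall>\<^sub>F \<epsilon> in at_right 0. (A *v y) $ i + (c * \<epsilon>) * (A *v z) $ i < u $ i"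
          using lt by (auto dest: order_tendstoD)
        then show ?thesis unfolding eq by eventually_elim simp
      qed
    qed
    then have ev: "\<forall>\<^sub>F \<epsilon> in at_right 0. y + (c * \<epsilon>) *\<^sub>R z \<in> P" for c :: real
      unfolding P_def less_eq_vec_def mem_Collect_eq all_conj_distrib[symmetric]
      by (intro eventually_all_finite)
    have "\<forall>\<^sub>F \<epsilon> in at_right (0::real). 0 < \<epsilon> \<and> y + (1 * \<epsilon>) *\<^sub>R z \<in> P \<and> y + (- 1 * \<epsilon>) *\<^sub>R z \<in> P"
      using ev[of 1] ev[of "- 1"] eventually_at_right_less[of 0] by eventually_elim blast
    then obtain \<epsilon> :: real where \<epsilon>: "0 < \<epsilon>" "y + \<epsilon> *\<^sub>R z \<in> P" "y - \<epsilon> *\<^sub>R z \<in> P"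
      using eventually_happens[of _ "at_right (0::real)"] by force
    have "y = midpoint (y + \<epsilon> *\<^sub>R z) (y - \<epsilon> *\<^sub>R z)"
      by (simp add: midpoint_def flip: scaleR_2)
    moreover have "y + \<epsilon> *\<^sub>R z \<noteq> y - \<epsilon> *\<^sub>R z"
    proof
      assume "y + \<epsilon> *\<^sub>R z = y - \<epsilon> *\<^sub>R z"
      then have "(2 * \<epsilon>) *\<^sub>R z = 0" by (simp add: algebra_simps flip: scaleR_2)
      then show False using \<epsilon>(1) z(1) by simp
    qed
    ultimately have "y \<in> open_segment (y + \<epsilon> *\<^sub>R z) (y - \<epsilon> *\<^sub>R z)"
      using midpoint_in_open_segment by metis
    then show False using y \<epsilon> by (auto simp: extreme_point_of_def)
  qed
  then have "y $ j \<in> \<int>" for j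
    using spanning_rows_solution_in_Ints[OF tu] unfolding I_def by blast
  then show ?thesis using that yP unfolding P_def by blast
qed

section \<open>Integer decomposition of totally unimodular polytopes\<close>

text \<open>One integral point is split off so that the remainder satisfies the hypothesis with one
  summand fewer. Counting from \<open>Suc n\<close> makes the single summand \<open>Y\<close> itself
  the base case.\<close>

lemma totally_unimodular_integer_decomposition:
  fixes A :: "real ^ 'n ^ 'm"
  assumes tu: "totally_unimodular A"
    and b: "\<And>i. b $ i \<in> \<int>"
    and bounded: "bounded {y. A *v y \<le> b}"
    and Y: "A *v Y \<le> real (Suc n) *\<^sub>R b" "\<And>j. Y $ j \<in> \<int>"
  shows "\<exists>y. (\<forall>i. A *v y i \<le> b \<and> (\<forall>j. y i $ j \<in> \<int>)) \<and> Y = (\<Sum>i = 1..Suc n. y i)"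
  using Y
proof (induction n arbitrary: Y)
  case 0
  then show ?case by (intro exI[of _ "\<lambda>_. Y"]) simp
next
  case (Suc n)
  define N where "N = real (Suc n)"
  have N: "N > 0" by (simp add: N_def)
  have AY: "(A *v Y) $ i \<le> (N + 1) * b $ i" for i
    using Suc.prems(1) by (simp add: less_eq_vec_def N_def algebra_simps)
  \<comment> \<open>The bound \<open>l \<le> A *v y\<close> says exactly that the remainder
    satisfies \<open>A *v (Y - y) \<le> N *\<^sub>R b\<close>.\<close>
  define l where "l = A *v Y - N *\<^sub>R b"
  have l_int: "l $ i \<in> \<int>" for i
    unfolding l_def N_def using Suc.prems(2) totally_unimodular_entry_in_Ints[OF tu] b
    by (auto simp: matrix_vector_mult_def intro!: Ints_diff Ints_sum Ints_mult)
  \<comment> \<open>Here \<open>Y\<close> is to be split into \<open>N + 1\<close> summands, and the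
    equal fractional share satisfies both bounds. Only nonemptiness is needed from it; the integral
    point comes from the polytope.\<close>
  have "inverse (N + 1) *\<^sub>R Y \<in> {y. l \<le> A *v y \<and> A *v y \<le> b}"
  proof -
    have "(A *v Y) $ i - N * b $ i \<le> inverse (N + 1) * (A *v Y) $ i"
      "inverse (N + 1) * (A *v Y) $ i \<le> b $ i" for i
    proof -
      have "N * (A *v Y) $ i \<le> N * ((N + 1) * b $ i)"
        using AY N by (intro mult_left_mono) auto
      then show "(A *v Y) $ i - N * b $ i \<le> inverse (N + 1) * (A *v Y) $ i"
        using N by (simp add: field_simps)
      show "inverse (N + 1) * (A *v Y) $ i \<le> b $ i"
        using AY[of i] N by (simp add: field_simps)
    qed
    then show ?thesis by (simp add: l_def less_eq_vec_def matrix_vector_mult_scaleR)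
  qed
  then have "{y. l \<le> A *v y \<and> A *v y \<le> b} \<noteq> {}" by blast
  moreover have "bounded {y. l \<le> A *v y \<and> A *v y \<le> b}"
    by (rule bounded_subset[OF bounded]) auto
  ultimately obtain y' where y': "l \<le> A *v y'" "A *v y' \<le> b" "\<And>j. y' $ j \<in> \<int>"
    using totally_unimodular_integral_point[OF tu l_int b] by blast
  have "A *v (Y - y') \<le> real (Suc n) *\<^sub>R b"
    using y'(1) unfolding less_eq_vec_def l_def N_def
    by (simp add: matrix_vector_mult_diff_distrib algebra_simps)
  then have "\<exists>y. (\<forall>i. A *v y i \<le> b \<and> (\<forall>j. y i $ j \<in> \<int>)) \<and> Y - y' = (\<Sum>i = 1..Suc n. y i)"
    using Suc.prems(2) y'(3) by (intro Suc.IH) (auto intro: Ints_diff)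
  then obtain y where y: "\<And>i. A *v y i \<le> b" "\<And>i j. y i $ j \<in> \<int>" "Y - y' = (\<Sum>i = 1..Suc n. y i)"
    by blast
  \<comment> \<open>The updated index lies just beyond the range of the inductive sum, so the
    earlier summands are unchanged.\<close>
  define w where "w = y(Suc (Suc n) := y')"
  have "(\<Sum>i = 1..Suc (Suc n). w i) = (\<Sum>i = 1..Suc n. y i) + y'"
    by (auto simp: w_def intro!: sum.cong)
  then have "Y = (\<Sum>i = 1..Suc (Suc n). w i)" using y(3) by (metis diff_add_cancel)
  then show ?case using y(1,2) y'(2,3) by (intro exI[of _ w]) (auto simp: w_def)
qed

section \<open>Blocks of coordinates, sublevel sets and multiples of sets\<close>

lemma subvec_sum: "subvec blk s (\<Sum>i\<in>I. x i) = (\<Sum>i\<in>I. subvec blk s (x i))"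
  by (induction I rule: infinite_finite_induct) (auto simp: subvec_def vec_eq_iff)

lemma sum_subvec:
  fixes blk :: "'d::finite \<Rightarrow> 'k::finite"
  shows "(\<Sum>s\<in>UNIV. subvec blk s x) = x"
  by (simp add: subvec_def vec_eq_iff)

text \<open>With blocks realised as coordinate subspaces, concatenation is summation: at coordinate
  \<open>i\<close> only the term of block \<open>blk i\<close> can be nonzero.\<close>

lemma subvec_sum_block_space:
  fixes blk :: "'d::finite \<Rightarrow> 'k::finite"
  assumes "\<And>s. w s \<in> block_space blk s"
  shows "subvec blk t (\<Sum>s\<in>UNIV. w s) = w t"
proof -
  have "w s $ i = (if blk i = s then w s $ i else 0)" for s i
    using assms[of s] by (auto simp: block_space_def)
  then have "(\<Sum>s\<in>UNIV. w s $ i) = (\<Sum>s\<in>UNIV. if blk i = s then w s $ i else 0)" for i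
    by (intro sum.cong) auto
  then have "(\<Sum>s\<in>UNIV. w s $ i) = w (blk i) $ i" for i by simp
  moreover have "w t $ i = 0" if "blk i \<noteq> t" for i
    using assms[of t] that by (simp add: block_space_def)
  ultimately show ?thesis by (simp add: subvec_def vec_eq_iff)
qed

lemma subspace_block_space: "subspace (block_space blk s)"
  by (auto simp: block_space_def subspace_def)

text \<open>Convex combinations in the epigraph of \<open>h l\<close> leave the common second
  argument \<open>t\<close> and the common height \<open>d l\<close> fixed. This gives convexity of
  \<open>\<Lambda> s\<close> for \<open>t = 1\<close> and of \<open>\<Gamma> s\<close> for
  \<open>t = 0\<close>.\<close>

lemma convex_closed_convex_fun_on_sublevel:
  assumes "\<And>l. l \<in> L \<Longrightarrow> closed_convex_fun_on (S \<times> UNIV) (h l)" "convex S"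
  shows "convex {x \<in> S. \<forall>l\<in>L. h l (x, t) \<le> ereal (d l)}"
proof (rule convexI)
  fix x y and u v :: real
  assume x: "x \<in> {x \<in> S. \<forall>l\<in>L. h l (x, t) \<le> ereal (d l)}"
    and y: "y \<in> {x \<in> S. \<forall>l\<in>L. h l (x, t) \<le> ereal (d l)}"
    and uv: "0 \<le> u" "0 \<le> v" "u + v = 1"
  have comb: "u *\<^sub>R a + v *\<^sub>R a = a" for a :: "'z::real_vector"
    using uv(3) by (simp flip: scaleR_left_distrib)
  have "h l (u *\<^sub>R x + v *\<^sub>R y, t) \<le> ereal (d l)" if l: "l \<in> L" for l
  proof -
    have "((x, t), d l) \<in> ereal_epigraph (S \<times> UNIV) (h l)"
      "((y, t), d l) \<in> ereal_epigraph (S \<times> UNIV) (h l)"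
      using x y l by (auto simp: ereal_epigraph_def)
    then have "u *\<^sub>R ((x, t), d l) + v *\<^sub>R ((y, t), d l) \<in> ereal_epigraph (S \<times> UNIV) (h l)"
      using assms(1)[OF l] uv unfolding closed_convex_fun_on_def by (blast intro: convexD)
    then show ?thesis
      using comb[of t] comb[of "d l"] by (simp add: ereal_epigraph_def)
  qed
  moreover have "u *\<^sub>R x + v *\<^sub>R y \<in> S"
    using x y uv assms(2) by (auto intro: convexD)
  ultimately show "u *\<^sub>R x + v *\<^sub>R y \<in> {x \<in> S. \<forall>l\<in>L. h l (x, t) \<le> ereal (d l)}" by simp
qed

lemma nfold_sum_0: "nfold_sum 0 F = {0}"
  by (simp add: nfold_sum_def)

lemma nfold_sum_1: "nfold_sum (Suc 0) F = F"
proof -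
  have "\<exists>x. a = (\<Sum>i = 1..Suc 0. x i) \<and> (\<forall>i\<in>{1..Suc 0}. x i \<in> F)" if "a \<in> F" for a
    using that by (intro exI[of _ "\<lambda>_. a"]) simp
  then show ?thesis by (auto simp: nfold_sum_def)
qed

lemma dilate_eq_image:
  assumes "F \<noteq> {}" "0 \<le> c"
  shows "dilate c F = (\<lambda>x. c *\<^sub>R x) ` F"
  using assms by (auto simp: dilate_def)

text \<open>The sum is \<open>card I\<close> times the average, which lies in \<open>F\<close> by
  convexity. For empty \<open>I\<close> the separate zero case of \<open>dilate\<close>
  applies.\<close>

lemma sum_in_dilate_card:
  assumes "convex F" "finite I" "\<And>i. i \<in> I \<Longrightarrow> x i \<in> F"
  shows "(\<Sum>i\<in>I. x i) \<in> dilate (real (card I)) F"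
proof (cases "I = {}")
  case True
  then show ?thesis by (simp add: dilate_def)
next
  case False
  then have card: "0 < real (card I)" using assms(2) by (simp add: card_gt_0_iff)
  have "(\<Sum>i\<in>I. inverse (real (card I)) *\<^sub>R x i) \<in> F"
    using assms False by (intro convex_sum) auto
  moreover have "(\<Sum>i\<in>I. x i) = real (card I) *\<^sub>R (\<Sum>i\<in>I. inverse (real (card I)) *\<^sub>R x i)"
    using False assms(2) by (simp add: scaleR_sum_right)
  ultimately show ?thesis using card unfolding dilate_def by auto
qed

section \<open>The multiple of \<open>\<Omega>\<close> as an explicit mixed-integer set\<close>

theorem theorem2:
  fixes \<Omega> :: "((real ^ 'd) \<times> (real ^ 'k)) set"
    and blk :: "'d::finite \<Rightarrow> 'k::finite"
    and A :: "real ^ 'k ^ 'm"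
    and b :: "real ^ 'm"
    and H :: "'k \<Rightarrow> 'l set"
    and h :: "'l \<Rightarrow> (real ^ 'd) \<times> real \<Rightarrow> ereal"
    and d :: "'l \<Rightarrow> real"
    and \<Lambda> \<Gamma> :: "'k \<Rightarrow> (real ^ 'd) set"
    and r :: nat
  assumes finite_H: "\<And>s. finite (H s)"
    and closed_convex_h:
      "\<And>s l. l \<in> H s \<Longrightarrow> closed_convex_fun_on (block_space blk s \<times> UNIV) (h l)"
    and \<Lambda>_eq: "\<And>s. \<Lambda> s = {xs \<in> block_space blk s. \<forall>l\<in>H s. h l (xs, 1) \<le> ereal (d l)}"
    and \<Gamma>_eq: "\<And>s. \<Gamma> s = {xs \<in> block_space blk s. \<forall>l\<in>H s. h l (xs, 0) \<le> ereal (d l)}"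
    and \<Lambda>_nonempty: "\<And>s. \<Lambda> s \<noteq> {}"
    and \<Gamma>_nonempty: "\<And>s. \<Gamma> s \<noteq> {}"
    and tu_A: "totally_unimodular A"
    and integer_b: "\<And>i. b $ i \<in> \<int>"
    and polyhedron_in_box: "{y. A *v y \<le> b} \<subseteq> {y. \<forall>s. 0 \<le> y $ s \<and> y $ s \<le> 1}"
    and \<Omega>_eq: "\<Omega> = {(x, y).
          (\<forall>s. subvec blk s x \<in>
                 nfold_sum (nat \<lfloor>y $ s\<rfloor>) (\<Lambda> s) + nfold_sum (nat \<lfloor>1 - y $ s\<rfloor>) (\<Gamma> s)) \<and>
          A *v y \<le> b \<and> (\<forall>s. y $ s \<in> {0, 1})}"
    and \<Omega>_nonempty: "\<Omega> \<noteq> {}"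
    and \<Omega>_bounded: "bounded \<Omega>"
  shows "nfold_sum r \<Omega> = {(X, Y).
          (\<forall>s. subvec blk s X \<in>
                 dilate (Y $ s) (\<Lambda> s) + dilate (real r - Y $ s) (\<Gamma> s)) \<and>
          A *v Y \<le> real r *\<^sub>R b \<and> (\<forall>s. Y $ s \<in> real ` {0..r})}"
proof -
  have \<Lambda>_convex: "convex (\<Lambda> s)" and \<Gamma>_convex: "convex (\<Gamma> s)" for s
    unfolding \<Lambda>_eq \<Gamma>_eq
    by (intro convex_closed_convex_fun_on_sublevel closed_convex_h
        subspace_imp_convex subspace_block_space; assumption)+
  \<comment> \<open>For binary \<open>y\<close> the multiplicities are 1 and 0 in some order, so the
    set sum collapses to \<open>\<Lambda> s\<close> or \<open>\<Gamma> s\<close>.\<close>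
  have \<Omega>_iff: "(x, y) \<in> \<Omega> \<longleftrightarrow> A *v y \<le> b \<and> (\<forall>s. y $ s = 1 \<and> subvec blk s x \<in> \<Lambda> s \<or>
      y $ s = 0 \<and> subvec blk s x \<in> \<Gamma> s)" for x y
  proof -
    have "y $ s \<in> {0, 1} \<and> subvec blk s x \<in>
          nfold_sum (nat \<lfloor>y $ s\<rfloor>) (\<Lambda> s) + nfold_sum (nat \<lfloor>1 - y $ s\<rfloor>) (\<Gamma> s) \<longleftrightarrow>
        y $ s = 1 \<and> subvec blk s x \<in> \<Lambda> s \<or> y $ s = 0 \<and> subvec blk s x \<in> \<Gamma> s" for s
      by (auto simp: nfold_sum_0 nfold_sum_1 set_plus_def)
    then show ?thesis unfolding \<Omega>_eq by blast
  qed
  define R where "R = {(X, Y).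
      (\<forall>s. subvec blk s X \<in> dilate (Y $ s) (\<Lambda> s) + dilate (real r - Y $ s) (\<Gamma> s)) \<and>
      A *v Y \<le> real r *\<^sub>R b \<and> (\<forall>s. Y $ s \<in> real ` {0..r})}"
  have "nfold_sum r \<Omega> = R"
  \<comment> \<open>For \<open>r = 0\<close> both sides are the zero set: \<open>Y\<close> vanishes,
    hence so does every block of \<open>X\<close>. The decomposition into \<open>Suc n\<close>
    summands needs \<open>r\<close> positive.\<close>
  proof (cases r)
    case 0
    have "X = 0" if "\<And>s. subvec blk s X = 0" for X
      using sum_subvec[of blk X] that by simp
    moreover have "subvec blk s 0 = 0" for s
      by (simp add: subvec_def vec_eq_iff)
    ultimately show ?thesis
      by (auto simp: R_def 0 nfold_sum_0 dilate_def zero_prod_def vec_eq_iff[of _ 0] set_plus_def)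
  next
    case (Suc n)
    have "nfold_sum r \<Omega> \<subseteq> R"
    proof
      fix Z assume "Z \<in> nfold_sum r \<Omega>"
      then obtain z where z: "Z = (\<Sum>i = 1..r. z i)" "\<And>i. i \<in> {1..r} \<Longrightarrow> z i \<in> \<Omega>"
        using Suc by (auto simp: nfold_sum_def)
      define x y where "x = fst \<circ> z" and "y = snd \<circ> z"
      have Z: "Z = (\<Sum>i = 1..r. x i, \<Sum>i = 1..r. y i)"
        by (simp add: z(1) x_def y_def prod_eq_iff fst_sum snd_sum)
      have xy: "(x i, y i) \<in> \<Omega>" if "i \<in> {1..r}" for i
        using z(2)[OF that] by (simp add: x_def y_def)
      \<comment> \<open>\<open>J s\<close> collects the summands whose block \<open>s\<close> lies
        in \<open>\<Lambda> s\<close>; for the others it lies in \<open>\<Gamma> s\<close>. Its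
        cardinality is the entry \<open>s\<close> of the summed \<open>y\<close>, and the two groups
        of blocks are averaged separately.\<close>
      define J where "J s = {i \<in> {1..r}. y i $ s = 1}" for s
      have J: "J s \<subseteq> {1..r}" for s by (auto simp: J_def)
      have card_J: "card (J s) \<le> r" for s
        using card_mono[OF _ J, of s] by simp
      have Y: "(\<Sum>i = 1..r. y i) $ s = real (card (J s))" for s
      proof -
        have "(\<Sum>i = 1..r. y i) $ s = (\<Sum>i = 1..r. if y i $ s = 1 then 1 else 0)"
          using xy unfolding \<Omega>_iff sum_component by (intro sum.cong) auto
        also have "\<dots> = real (card (J s))"
          by (simp add: J_def Int_def flip: sum.inter_filter)
        finally show ?thesis .
      qed
      have "subvec blk s (\<Sum>i = 1..r. x i) \<in>
          dilate (real (card (J s))) (\<Lambda> s) + dilate (real r - real (card (J s))) (\<Gamma> s)" for s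
      proof -
        have "(\<Sum>i\<in>J s. subvec blk s (x i)) \<in> dilate (real (card (J s))) (\<Lambda> s)"
          using xy by (intro sum_in_dilate_card \<Lambda>_convex) (force simp: J_def \<Omega>_iff)+
        moreover have "(\<Sum>i\<in>{1..r} - J s. subvec blk s (x i)) \<in> dilate (real (card ({1..r} - J s))) (\<Gamma> s)"
          using xy by (intro sum_in_dilate_card \<Gamma>_convex) (force simp: J_def \<Omega>_iff)+
        moreover have "real (card ({1..r} - J s)) = real r - real (card (J s))"
          using J card_J by (simp add: card_Diff_subset finite_subset[OF J])
        moreover have "subvec blk s (\<Sum>i = 1..r. x i) =
            (\<Sum>i\<in>J s. subvec blk s (x i)) + (\<Sum>i\<in>{1..r} - J s. subvec blk s (x i))"
          using sum.subset_diff[OF J, of "\<lambda>i. subvec blk s (x i)"] by (simp add: subvec_sum add.commute)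
        ultimately show ?thesis by (simp add: set_plus_intro)
      qed
      moreover have "A *v (\<Sum>i = 1..r. y i) \<le> real r *\<^sub>R b"
      proof -
        have "(\<Sum>i = 1..r. (A *v y i) $ j) \<le> (\<Sum>i = 1..r. b $ j)" for j
          using xy by (intro sum_mono) (auto simp: \<Omega>_iff less_eq_vec_def)
        then show ?thesis
          by (simp add: less_eq_vec_def linear_sum[OF matrix_vector_mul_linear])
      qed
      ultimately show "Z \<in> R"
        using card_J unfolding Z R_def mem_Collect_eq split Y by auto
    qed
    moreover have "R \<subseteq> nfold_sum r \<Omega>"
    proof (rule subrelI)
      fix X Y assume "(X, Y) \<in> R"
      then have X: "\<And>s. subvec blk s X \<in> dilate (Y $ s) (\<Lambda> s) + dilate (real r - Y $ s) (\<Gamma> s)"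
        and AY: "A *v Y \<le> real r *\<^sub>R b" and Y: "\<And>s. Y $ s \<in> real ` {0..r}"
        unfolding R_def mem_Collect_eq split by blast+
      have "bounded {y. A *v y \<le> b}"
        by (rule bounded_subset[OF bounded_cbox[of 0 1]])
          (use polyhedron_in_box in \<open>auto simp: mem_box_cart\<close>)
      moreover have "Y $ s \<in> \<int>" for s using Y[of s] by auto
      ultimately have "\<exists>y. (\<forall>i. A *v y i \<le> b \<and> (\<forall>j. y i $ j \<in> \<int>)) \<and> Y = (\<Sum>i = 1..r. y i)"
        using AY unfolding Suc
        by (intro totally_unimodular_integer_decomposition[OF tu_A integer_b])
      then obtain y where y: "\<And>i. A *v y i \<le> b" "\<And>i j. y i $ j \<in> \<int>" "Y = (\<Sum>i = 1..r. y i)"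
        by metis
      \<comment> \<open>The polyhedron lies in the unit box, whose integral points are the binary
        vectors.\<close>
      have y01: "y i $ s = 0 \<or> y i $ s = 1" for i s
      proof -
        obtain k where "y i $ s = of_int k" using y(2)[of i s] by (elim Ints_cases)
        moreover have "0 \<le> y i $ s" "y i $ s \<le> 1" using polyhedron_in_box y(1)[of i] by auto
        ultimately show ?thesis by simp linarith
      qed
      \<comment> \<open>Nonemptiness turns \<open>dilate\<close> into a plain scalar image even for
        factor 0, so points \<open>p\<close> and \<open>q\<close> exist also when one coefficient
        vanishes.\<close>
      have "\<exists>p q. p \<in> \<Lambda> s \<and> q \<in> \<Gamma> s \<and> subvec blk s X = (Y $ s) *\<^sub>R p + (real r - Y $ s) *\<^sub>R q" for s
      proof -
        have "0 \<le> Y $ s" "0 \<le> real r - Y $ s" using Y[of s] by auto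
        then show ?thesis
          using X[of s] \<Lambda>_nonempty \<Gamma>_nonempty by (auto simp: dilate_eq_image elim!: set_plus_elim)
      qed
      then obtain p q where p: "\<And>s. p s \<in> \<Lambda> s" and q: "\<And>s. q s \<in> \<Gamma> s"
        and X_eq: "\<And>s. subvec blk s X = (Y $ s) *\<^sub>R p s + (real r - Y $ s) *\<^sub>R q s"
        by metis
      \<comment> \<open>The same \<open>p s\<close> and \<open>q s\<close> serve all summands:
        \<open>y i\<close> selects which of them becomes block \<open>s\<close> of
        \<open>x i\<close>. Over all \<open>i\<close> the coefficients add up to
        \<open>Y $ s\<close> and \<open>real r - Y $ s\<close>, which restores block
        \<open>s\<close> of \<open>X\<close>.\<close>
      define w where "w i s = (y i $ s) *\<^sub>R p s + (1 - y i $ s) *\<^sub>R q s" for i s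
      define x where "x i = (\<Sum>s\<in>UNIV. w i s)" for i
      have w: "y i $ s = 1 \<and> w i s \<in> \<Lambda> s \<or> y i $ s = 0 \<and> w i s \<in> \<Gamma> s" for i s
        using y01[of i s] p q by (auto simp: w_def)
      then have "w i s \<in> block_space blk s" for i s
        unfolding \<Lambda>_eq \<Gamma>_eq by blast
      then have "subvec blk s (x i) = w i s" for i s
        by (simp add: x_def subvec_sum_block_space)
      then have "(x i, y i) \<in> \<Omega>" for i
        using w y(1) by (simp add: \<Omega>_iff)
      moreover have "X = (\<Sum>i = 1..r. x i)"
      proof -
        have "(\<Sum>i = 1..r. w i s) = subvec blk s X" for s
          unfolding X_eq w_def sum.distrib y(3)
          by (simp add: sum_subtractf scaleR_diff_left sum_constant_scaleR del: sum_constant flip: scaleR_left.sum)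
        then have "X = (\<Sum>s\<in>UNIV. \<Sum>i = 1..r. w i s)" by (simp add: sum_subvec)
        also have "\<dots> = (\<Sum>i = 1..r. x i)" unfolding x_def by (rule sum.swap)
        finally show ?thesis .
      qed
      ultimately show "(X, Y) \<in> nfold_sum r \<Omega>"
        using Suc y(3) unfolding nfold_sum_def
        by (auto simp: prod_eq_iff fst_sum snd_sum intro!: exI[of _ "\<lambda>i. (x i, y i)"])
    qed
    ultimately show ?thesis by blast
  qed
  then show ?thesis by (simp add: R_def)
qed

end
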